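(* Let $b$ and $q$ be distinct quadric surfaces in $P_3(\mathbb{C})$, both of rank at least three. Then $b$ is a basket for $q$ if and only if the pencil $[b,q]=\{\lambda b+\mu q\ :\ (\lambda:\mu)\in P_1(\mathbb{C})\}\subset P_9$ meets the rank one locus (i.e. contains a double-plane).
   Context: Quadric surfaces in $P_3=P_3(\mathbb{C})$ are identified with points of $P_9=P(\mathrm{Sym}_{\mathbb{C}}(4))$, the projectivization of the space of complex symmetric $4\times4$ matrices, via $q(x)=\langle x,Qx\rangle=\sum q_{ij}x_ix_j$; the rank of $q$ is the rank of $Q$. A quadric of rank one is called a double-plane; the rank one locus is the set of rank one points of $P_9$. Basket: for distinct quadric surfaces $q_1,q_2$ of rank at least three, $q_1$ is a basket for $q_2$ (and then $q_2$ is a basket for $q_1$) when the two quadrics are tangent along a conic, so that the intersection of the two quadrics is represented by twice this conic. *)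

theory Defs
  imports "HOL-Analysis.Analysis"
begin

(* The pairing <x,y> = sum x_i y_i is complex bilinear, not Hermitian; the library's inner
   product on complex^4 is a real inner product and is not what is meant. *)
definition bilin :: "complex^4 \<Rightarrow> complex^4 \<Rightarrow> complex" where
  "bilin x y = (\<Sum>i\<in>UNIV. x $ i * y $ i)"

definition qform :: "complex^4^4 \<Rightarrow> complex^4 \<Rightarrow> complex" where
  "qform Q x = bilin x (Q *v x)"

(* A point of a projective space P(V) is encoded as the set of all its representatives in V,
   that is, as a line through the origin of V with the origin removed. *)
definition point_of :: "complex^4 \<Rightarrow> (complex^4) set" where
  "point_of x = {c *s x | c. c \<noteq> 0}"

definition P3 :: "(complex^4) set set" where
  "P3 = {point_of x | x. x \<noteq> 0}"

definition mscale :: "complex \<Rightarrow> complex^4^4 \<Rightarrow> complex^4^4" where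
  "mscale c Q = (\<chi> i j. c * Q $ i $ j)"

definition quadric_of :: "complex^4^4 \<Rightarrow> (complex^4^4) set" where
  "quadric_of Q = {mscale c Q | c. c \<noteq> 0}"

definition P9 :: "(complex^4^4) set set" where
  "P9 = {quadric_of Q | Q. transpose Q = Q \<and> Q \<noteq> 0}"

(* All representatives of a quadric have the same rank, so the description is proper on P9. *)
definition quadric_rank :: "(complex^4^4) set \<Rightarrow> nat" where
  "quadric_rank q = (THE r. \<exists>Q\<in>q. rank Q = r)"

definition rank_one_locus :: "(complex^4^4) set set" where
  "rank_one_locus = {q \<in> P9. quadric_rank q = 1}"

definition pencil :: "(complex^4^4) set \<Rightarrow> (complex^4^4) set \<Rightarrow> (complex^4^4) set set" where
  "pencil b q = {quadric_of (mscale l B + mscale m Q) | l m B Q.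
                   B \<in> b \<and> Q \<in> q \<and> (l, m) \<noteq> (0, 0)}"

(* The point set in P3 underlying a quadric. *)
definition zero_set :: "(complex^4^4) set \<Rightarrow> (complex^4) set set" where
  "zero_set q = {p \<in> P3. \<exists>Q\<in>q. \<exists>x\<in>p. qform Q x = 0}"

definition planes :: "(complex^4) set set set" where
  "planes = {{p \<in> P3. \<exists>x\<in>p. bilin u x = 0} | u. u \<noteq> 0}"

(* A conic is a plane curve of degree two, cut out on a plane by a quadric that does not
   contain the plane.  Degenerate conics are included: pairs of lines and double lines (whose
   point set is a line).  They do occur as contact curves, for instance when a smooth quadric
   touches another one along its section by a tangent plane, or when two cones with common
   vertex touch along a double line.  A conic is determined by its point set. *)
definition conics :: "(complex^4) set set set" where
  "conics = {H \<inter> zero_set s | H s. H \<in> planes \<and> s \<in> P9 \<and> \<not> H \<subseteq> zero_set s}"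

definition smooth_at :: "(complex^4^4) set \<Rightarrow> (complex^4) set \<Rightarrow> bool" where
  "smooth_at q p \<longleftrightarrow> p \<in> zero_set q \<and> (\<exists>Q\<in>q. \<exists>x\<in>p. Q *v x \<noteq> 0)"

(* The gradient of the form x |-> <x,Qx> at x is 2 Qx. *)
definition tangent_plane :: "(complex^4^4) set \<Rightarrow> (complex^4) set \<Rightarrow> (complex^4) set set" where
  "tangent_plane q p = {r \<in> P3. \<exists>Q\<in>q. \<exists>x\<in>p. \<exists>y\<in>r. bilin (Q *v x) y = 0}"

(* Quadrics of rank at least three have at most one singular point (the vertex of the cone),
   so only finitely many points of the curve C are left out of the comparison of tangent
   planes. *)
definition tangent_along ::
    "(complex^4^4) set \<Rightarrow> (complex^4^4) set \<Rightarrow> (complex^4) set set \<Rightarrow> bool" where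
  "tangent_along b q C \<longleftrightarrow> C \<subseteq> zero_set b \<inter> zero_set q \<and>
     (\<forall>p\<in>C. smooth_at b p \<and> smooth_at q p \<longrightarrow> tangent_plane b p = tangent_plane q p)"

(* The quadrics are tangent along the conic C, and C is their whole intersection.  This is what
   it means for the intersection cycle of b and q to be 2C: tangency along C says that every
   component of C has multiplicity at least two in the intersection, nothing else occurs in it,
   and the degree of the intersection is four by Bezout, that is twice the degree of C.  (If C
   is a double line, the cycle is four times the line.)  Tangency alone would not suffice:
   two cones can be tangent along a line and meet in a further, residual conic.  Nor would
   equality of point sets: two cones with common vertex can meet along two lines with
   multiplicities three and one. *)
definition basket :: "(complex^4^4) set \<Rightarrow> (complex^4^4) set \<Rightarrow> bool" where
  "basket b q \<longleftrightarrow> b \<in> P9 \<and> q \<in> P9 \<and> b \<noteq> q \<and> quadric_rank b \<ge> 3 \<and> quadric_rank q \<ge> 3 \<and>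
     (\<exists>C\<in>conics. tangent_along b q C \<and> zero_set b \<inter> zero_set q = C)"

end

theory Submission
  imports Defs
begin

text \<open>If a pencil member is a double plane 2H, then q agrees with b up to a multiple of the square
  of the equation of H, so the two quadrics have the same section with H, the same tangent planes
  along it, and no other common point.

  Conversely, tangency says that the polar vectors Bx and Qx are parallel at every common zero x.
  Let the contact conic be cut out on H by a form S.  If S is reduced on H, then B and Q restrict
  on H to multiples of S, so some pencil member T vanishes on H; parallelism at points of the conic
  forces T to be a multiple of the square of the equation of H.  If S is a double line L on H, the
  pairings of B and Q between L and a complement are 2 by 2 blocks.  Parallelism along L and the
  absence of common zeros off L make these blocks proportional, so some pencil member T is a binary
  form on the complement.  Each zero of T lies in the kernel of the block of B; as this block is
  nonzero, T has only one zero and is a square.  In this case the double plane need not be H.\<close>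

section \<open>Bilinear forms\<close>

text \<open>The polar vector \<open>M *v x\<close> stands in the first slot, as in
  \<open>tangent_plane\<close>; exchanging \<open>x\<close> and \<open>y\<close> needs
  \<open>M\<close> symmetric.\<close>

definition bform :: "complex^4^4 \<Rightarrow> complex^4 \<Rightarrow> complex^4 \<Rightarrow> complex" where
  "bform M x y = bilin (M *v x) y"

lemma bilin_simps:
  "bilin (x + y) z = bilin x z + bilin y z" "bilin x (y + z) = bilin x y + bilin x z"
  "bilin (x - y) z = bilin x z - bilin y z" "bilin x (y - z) = bilin x y - bilin x z"
  "bilin (c *s x) y = c * bilin x y" "bilin x (c *s y) = c * bilin x y"
  "bilin 0 y = 0" "bilin x 0 = 0"
  by (simp_all add: bilin_def sum_4 algebra_simps)

lemma bilin_commute: "bilin x y = bilin y x"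
  by (simp add: bilin_def mult.commute)

lemma bilin_axis: "bilin v (axis i 1) = v $ i"
  by (simp add: bilin_def axis_def if_distrib cong: if_cong)

lemma bilin_eqI: "(\<And>y. bilin v y = bilin w y) \<Longrightarrow> v = w"
  by (metis bilin_axis vec_eq_iff)

lemma bilin_nonzero:
  assumes "u \<noteq> 0" obtains w where "bilin u w = 1"
proof -
  obtain i where "u $ i \<noteq> 0" using assms by (auto simp: vec_eq_iff)
  then have "bilin u ((1 / u $ i) *s axis i 1) = 1" by (simp add: bilin_simps bilin_axis)
  then show thesis by (rule that)
qed

lemma bform_simps:
  "bform M (x + y) z = bform M x z + bform M y z" "bform M x (y + z) = bform M x y + bform M x z"
  "bform M (x - y) z = bform M x z - bform M y z" "bform M x (y - z) = bform M x y - bform M x z"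
  "bform M (c *s x) y = c * bform M x y" "bform M x (c *s y) = c * bform M x y"
  "bform M 0 y = 0" "bform M x 0 = 0"
  by (simp_all add: bform_def bilin_simps matrix_vector_right_distrib
      matrix_vector_mult_diff_distrib vector_scalar_commute)

lemma qform_bform: "qform M x = bform M x x"
  by (simp add: qform_def bform_def bilin_commute)

lemma bform_sym:
  assumes "transpose M = M" shows "bform M x y = bform M y x"
proof -
  have "M $ i $ j = M $ j $ i" for i j
    by (subst assms[symmetric]) (simp add: transpose_def)
  then show ?thesis
    unfolding bform_def bilin_def matrix_vector_mult_def
    by (simp add: sum_4 algebra_simps)
qed

lemma mscale_mult: "mscale c M *v x = c *s (M *v x)"
  by (simp add: mscale_def matrix_vector_mult_def vec_eq_iff sum_distrib_left mult.assoc)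

lemma bform_mscale: "bform (mscale c M) x y = c * bform M x y"
  by (simp add: bform_def mscale_mult bilin_simps)

lemma bform_pencil:
  "bform (mscale l B + mscale m Q) x y = l * bform B x y + m * bform Q x y"
  by (simp add: bform_def matrix_vector_mult_add_rdistrib mscale_mult bilin_simps)

lemma transpose_pencil:
  "transpose B = B \<Longrightarrow> transpose Q = Q \<Longrightarrow>
    transpose (mscale l B + mscale m Q) = mscale l B + mscale m Q"
  by (simp add: mscale_def transpose_def vec_eq_iff)

lemma bform_eq_0_iff: "(\<forall>y. bform M x y = 0) \<longleftrightarrow> M *v x = 0"
  unfolding bform_def using bilin_eqI[of "M *v x" 0] by (auto simp: bilin_simps)

lemma polarization:
  assumes "transpose M = M"
  shows "2 * bform M x y = qform M (x + y) - qform M x - qform M y"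
  using bform_sym[OF assms, of x y] by (simp add: qform_bform bform_simps)

section \<open>Rank\<close>

lemma mult_axis: "M *v axis i 1 = column i M" for M :: "complex^4^4"
  by (simp add: matrix_vector_mult_def column_def axis_def if_distrib vec_eq_iff cong: if_cong)

text \<open>The rank is the dimension of the row space. For symmetric \<open>M\<close> the rows are
  the columns, and these are the images of the coordinate vectors.\<close>

lemma rank_sym_le:
  fixes M :: "complex^4^4"
  assumes "transpose M = M" "finite W" "\<And>x. M *v x \<in> vec.span W"
  shows "rank M \<le> card W"
proof -
  have "rows M = columns M" by (metis assms(1) rows_transpose)
  moreover have "columns M \<subseteq> vec.span W"
    using assms(3)[of "axis i 1" for i] by (auto simp: columns_def mult_axis)
  ultimately show ?thesis
    by (simp add: row_rank_def_gen vec.dim_le_card assms(2))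
qed

lemma rank_sym_le_1:
  fixes M :: "complex^4^4"
  assumes "transpose M = M" "\<And>x. \<exists>a. M *v x = a *s p"
  shows "rank M \<le> 1"
proof -
  have "M *v x \<in> vec.span {p}" for x
    using assms(2)[of x] by (auto simp: vec.span_singleton)
  from rank_sym_le[OF assms(1) _ this] show ?thesis by simp
qed

lemma rank_sym_le_2:
  fixes M :: "complex^4^4"
  assumes "transpose M = M" "\<And>x. \<exists>a b. M *v x = a *s p + b *s r"
  shows "rank M \<le> 2"
proof -
  have "M *v x \<in> vec.span {p, r}" for x
  proof -
    obtain a b where "M *v x = a *s p + b *s r" using assms(2) by blast
    then show ?thesis by (auto intro!: vec.span_add vec.span_scale intro: vec.span_base)
  qed
  from rank_sym_le[OF assms(1) _ this] have "rank M \<le> card {p, r}" by simp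
  also have "\<dots> \<le> 2" by (simp add: card_insert_if)
  finally show ?thesis .
qed

lemma rank_0_iff: "rank (M :: complex^4^4) = 0 \<longleftrightarrow> M = 0"
proof -
  have "vec.dim (rows M) = 0 \<longleftrightarrow> rows M \<subseteq> {0}" by (rule vec.dim_eq_0)
  also have "\<dots> \<longleftrightarrow> M = 0" by (force simp: rows_def row_def vec_eq_iff)
  finally show ?thesis by (simp add: row_rank_def_gen)
qed

text \<open>All rows are multiples of one vector \<open>u\<close>, and symmetry makes the factors
  proportional to the entries of \<open>u\<close>. The form of \<open>M\<close> is thus
  \<open>c\<close> times the square of a linear form, a double plane.\<close>

lemma rank_1_symE:
  fixes M :: "complex^4^4"
  assumes "transpose M = M" "rank M = 1"
  obtains u c where "u \<noteq> 0" "c \<noteq> 0" "\<And>x. M *v x = (c * bilin u x) *s u"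
proof -
  have sym: "M $ i $ j = M $ j $ i" for i j
    by (subst assms(1)[symmetric]) (simp add: transpose_def)
  obtain W where W: "W \<subseteq> rows M" "rows M \<subseteq> vec.span W" "card W = 1"
    using vec.basis_exists[of "rows M"] assms(2) by (metis row_rank_def_gen)
  then obtain u where u: "W = {u}" by (meson card_1_singletonE)
  have "\<exists>a. M $ i = a *s u" for i
  proof -
    have "M $ i \<in> rows M" by (auto simp: rows_def row_def vec_eq_iff)
    then show ?thesis using W(2) by (auto simp: u vec.span_singleton)
  qed
  then obtain f where f: "\<And>i. M $ i = f i *s u" by metis
  have M0: "M \<noteq> 0" using rank_0_iff[of M] assms(2) by auto
  have u0: "u \<noteq> 0" using M0 f by (metis vec.scale_zero_right vec_eq_iff zero_index)
  then obtain k where k: "u $ k \<noteq> 0" by (auto simp: vec_eq_iff)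
  define c where "c = f k / u $ k"
  have fc: "f i = c * u $ i" for i
    using sym[of i k] k by (simp add: f c_def field_simps)
  show thesis
  proof
    show "u \<noteq> 0" by fact
    show "c \<noteq> 0" using M0 f fc by (auto simp: vec_eq_iff)
    show "M *v x = (c * bilin u x) *s u" for x
      by (simp add: vec_eq_iff matrix_vector_mult_def f fc bilin_def sum_4 algebra_simps)
  qed
qed

text \<open>By polarization \<open>bform M\<close> vanishes on the plane, so \<open>M\<close> sends
  the plane into the multiples of \<open>u\<close>; one vector \<open>w\<close> off the plane
  completes the image. Hence a quadric of rank at least three contains no plane.\<close>

lemma rank_le_2_if_contains_plane:
  fixes M :: "complex^4^4"
  assumes "transpose M = M" "u \<noteq> 0" "\<And>x. bilin u x = 0 \<Longrightarrow> qform M x = 0"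
  shows "rank M \<le> 2"
proof -
  obtain w where w: "bilin u w = 1" using bilin_nonzero assms(2) by blast
  have H: "bform M x y = 0" if "bilin u x = 0" "bilin u y = 0" for x y
    using polarization[OF assms(1), of x y] that assms(3) by (simp add: bilin_simps)
  have K: "M *v x = bform M x w *s u" if x: "bilin u x = 0" for x
  proof (rule bilin_eqI)
    fix z
    \<comment> \<open>The second argument is the projection of \<open>z\<close> to the plane along
      \<open>w\<close>.\<close>
    have "bform M x (z - bilin u z *s w) = 0" by (rule H) (simp_all add: x bilin_simps w)
    then show "bilin (M *v x) z = bilin (bform M x w *s u) z"
      by (simp add: bform_simps bilin_simps bform_def mult.commute)
  qed
  have "\<exists>a b. M *v z = a *s u + b *s (M *v w)" for z
  proof -
    have "bilin u (z - bilin u z *s w) = 0" by (simp add: bilin_simps w)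
    from K[OF this] have "M *v z - bilin u z *s (M *v w) = bform M (z - bilin u z *s w) w *s u"
      by (simp add: matrix_vector_mult_diff_distrib vector_scalar_commute)
    then show ?thesis by (metis diff_eq_eq)
  qed
  then show ?thesis by (rule rank_sym_le_2[OF assms(1)])
qed

section \<open>Frames\<close>

text \<open>Four spanning vectors in dimension four form a basis.\<close>

definition frame :: "complex^4 \<Rightarrow> complex^4 \<Rightarrow> complex^4 \<Rightarrow> complex^4 \<Rightarrow> bool" where
  "frame e1 e2 e3 e4 \<longleftrightarrow> (\<forall>x. \<exists>a b c d. x = a *s e1 + b *s e2 + c *s e3 + d *s e4)"

text \<open>Independence makes the coordinate map injective, hence surjective by equality of
  dimensions.\<close>

lemma frameI:
  assumes "\<And>a b c d. a *s e1 + b *s e2 + c *s e3 + d *s e4 = 0 \<Longrightarrow> a = 0 \<and> b = 0 \<and> c = 0 \<and> d = 0"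
  shows "frame e1 e2 e3 e4"
proof -
  define f :: "complex^4 \<Rightarrow> complex^4" where
    "f v = v $ 1 *s e1 + v $ 2 *s e2 + v $ 3 *s e3 + v $ 4 *s e4" for v
  have lin: "Vector_Spaces.linear (*s) (*s) f"
    by unfold_locales (simp_all add: f_def vec_eq_iff algebra_simps)
  have "v = 0" if "f v = 0" for v
    using assms[OF that[unfolded f_def]] by (simp add: vec_eq_iff forall_4)
  then have "inj f" using vec.linear_inj_iff_eq_0[OF lin] by blast
  then have "surj f" by (rule vec.linear_inj_imp_surj[OF lin])
  show ?thesis unfolding frame_def
  proof
    fix x
    obtain v where "x = f v" using \<open>surj f\<close> by (rule surjE)
    then show "\<exists>a b c d. x = a *s e1 + b *s e2 + c *s e3 + d *s e4" unfolding f_def by blast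
  qed
qed

lemma frame_eq_0:
  assumes "frame e1 e2 e3 e4"
    and "bform M x e1 = 0" "bform M x e2 = 0" "bform M x e3 = 0" "bform M x e4 = 0"
  shows "M *v x = 0"
proof -
  have "bform M x y = 0" for y
  proof -
    obtain a b c d where "y = a *s e1 + b *s e2 + c *s e3 + d *s e4"
      using assms(1) unfolding frame_def by blast
    then show ?thesis by (simp add: bform_simps assms)
  qed
  then show ?thesis by (simp add: bform_eq_0_iff[symmetric])
qed

lemma qform_frame:
  assumes "transpose M = M"
  shows "qform M (a *s e1 + b *s e2 + c *s e3 + d *s e4) =
    a^2 * bform M e1 e1 + b^2 * bform M e2 e2 + c^2 * bform M e3 e3 + d^2 * bform M e4 e4
    + 2*a*b * bform M e1 e2 + 2*a*c * bform M e1 e3 + 2*a*d * bform M e1 e4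
    + 2*b*c * bform M e2 e3 + 2*b*d * bform M e2 e4 + 2*c*d * bform M e3 e4"
  using bform_sym[OF assms, of e2 e1] bform_sym[OF assms, of e3 e1] bform_sym[OF assms, of e4 e1]
    bform_sym[OF assms, of e3 e2] bform_sym[OF assms, of e4 e2] bform_sym[OF assms, of e4 e3]
  by (simp add: qform_bform bform_simps algebra_simps power2_eq_square)

text \<open>Three linear conditions in dimension four are packed into an endomorphism whose image
  misses the last axis vector; not being surjective, it has a nonzero kernel.\<close>

lemma common_orthogonal:
  fixes a b c :: "complex^4"
  obtains x where "x \<noteq> 0" "bilin a x = 0" "bilin b x = 0" "bilin c x = 0"
proof -
  define f :: "complex^4 \<Rightarrow> complex^4" where
    "f x = bilin a x *s axis 1 1 + bilin b x *s axis 2 1 + bilin c x *s axis 3 1" for x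
  have lin: "Vector_Spaces.linear (*s) (*s) f"
    by unfold_locales (simp_all add: f_def bilin_simps vec_eq_iff algebra_simps)
  have comp: "f x $ 1 = bilin a x" "f x $ 2 = bilin b x" "f x $ 3 = bilin c x" "f x $ 4 = 0" for x
    by (simp_all add: f_def axis_def)
  have "axis 4 1 \<notin> range f"
  proof
    assume "axis 4 1 \<in> range f"
    then obtain x where "axis 4 1 = f x" by blast
    then have "(axis 4 1 :: complex^4) $ 4 = 0" using comp(4)[of x] by simp
    then show False by (simp add: axis_def)
  qed
  then have "\<not> inj f" using vec.linear_inj_imp_surj[OF lin] by blast
  then obtain x where "x \<noteq> 0" "f x = 0" using vec.linear_inj_iff_eq_0[OF lin] by blast
  then show thesis using that comp by (metis zero_index)
qed


section \<open>Contact along a reduced conic\<close>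

text \<open>The contact conic is normalised to \<open>2*a*c + s*b^2 = 0\<close> in the plane of
  \<open>e1\<close>, \<open>e2\<close>, \<open>e3\<close>: irreducible for \<open>s\<close> nonzero,
  a pair of lines for \<open>s = 0\<close>. A pencil member \<open>T\<close> vanishing on this plane
  turns out to annihilate \<open>e1\<close>, \<open>e2\<close>, \<open>e3\<close>, so its image is
  spanned by \<open>T *v e4\<close>.\<close>

lemma rank_1_of_contact_reduced:
  fixes B Q :: "complex^4^4"
  assumes symB: "transpose B = B" and symQ: "transpose Q = Q" and "rank B \<ge> 3"
    and u: "u \<noteq> 0" and fr: "frame e1 e2 e3 e4"
    and H: "bilin u e1 = 0" "bilin u e2 = 0" "bilin u e3 = 0" "bilin u e4 \<noteq> 0"
    and zeros: "\<And>a b c. 2*a*c + s*b^2 = 0 \<Longrightarrow>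
      qform B (a *s e1 + b *s e2 + c *s e3 + 0 *s e4) = 0 \<and>
      qform Q (a *s e1 + b *s e2 + c *s e3 + 0 *s e4) = 0"
    and tang: "\<And>x v w. qform B x = 0 \<Longrightarrow> qform Q x = 0 \<Longrightarrow>
      bform B x v * bform Q x w = bform B x w * bform Q x v"
  shows "\<exists>l m. (l, m) \<noteq> (0, 0) \<and> rank (mscale l B + mscale m Q) \<le> 1"
proof -
  \<comment> \<open>A form vanishing on the conic restricts to the plane as
    \<open>bform M e1 e3\<close> times the equation of the conic.\<close>
  have restr: "bform M e1 e1 = 0 \<and> bform M e1 e2 = 0 \<and> bform M e2 e3 = 0 \<and> bform M e3 e3 = 0 \<and>
      bform M e2 e2 = s * bform M e1 e3"
    if M: "transpose M = M"
      and z: "\<And>a b c. 2*a*c + s*b^2 = 0 \<Longrightarrow> qform M (a *s e1 + b *s e2 + c *s e3 + 0 *s e4) = 0" for M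
  proof -
    \<comment> \<open>Instantiations of \<open>q\<close> follow the first occurrences in the
      premise: \<open>a\<close>, \<open>c\<close>, \<open>b\<close>.\<close>
    note q = z[unfolded qform_frame[OF M]]
    have 11: "bform M e1 e1 = 0" using q[of 1 0 0] by simp
    have 33: "bform M e3 e3 = 0" using q[of 0 1 0] by simp
    \<comment> \<open>The points with \<open>a = 1\<close>, \<open>b = t\<close>,
      \<open>c = -s*t^2/2\<close> lie on the conic. The values 1, -1 and 2 of \<open>t\<close>
      suffice to kill all three coefficients.\<close>
    have P: "2*t * bform M e1 e2 + t^2 * (bform M e2 e2 - s * bform M e1 e3) - s*t^3 * bform M e2 e3 = 0" for t
      using q[of 1 "-s*t^2/2" t] by (simp add: 11 33 algebra_simps power2_eq_square power3_eq_cube)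
    have lin: "X = 0 \<and> Y = 0 \<and> Z = 0"
      if "2*X + Y - Z = 0" "- 2*X + Y + Z = 0" "4*X + 4*Y - 8*Z = 0" for X Y Z :: complex
    proof -
      have "Y = 0" using that(1,2) by algebra
      moreover have "Z = 2*X" using that(1) calculation by simp
      ultimately show ?thesis using that(3) by simp
    qed
    have "2 * bform M e1 e2 + (bform M e2 e2 - s * bform M e1 e3) - s * bform M e2 e3 = 0"
      using P[of 1] by simp
    moreover have "- 2 * bform M e1 e2 + (bform M e2 e2 - s * bform M e1 e3) + s * bform M e2 e3 = 0"
      using P[of "-1"] by simp
    moreover have "4 * bform M e1 e2 + 4 * (bform M e2 e2 - s * bform M e1 e3) - 8 * (s * bform M e2 e3) = 0"
      using P[of 2] by (simp add: algebra_simps)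
    ultimately have 12: "bform M e1 e2 = 0" and 22: "bform M e2 e2 = s * bform M e1 e3"
      and s23: "s * bform M e2 e3 = 0"
      using lin[of "bform M e1 e2" "bform M e2 e2 - s * bform M e1 e3" "s * bform M e2 e3"]
      by simp_all
    \<comment> \<open>For \<open>s = 0\<close> the curve behind \<open>P\<close> stays on the line
      \<open>c = 0\<close>; the missing coefficient is read off on the other line
      \<open>a = 0\<close>.\<close>
    have "bform M e2 e3 = 0"
    proof (cases "s = 0")
      case True
      then show ?thesis using q[of 0 1 1] by (simp add: 22 33)
    qed (use s23 in simp)
    then show ?thesis using 11 12 22 33 by simp
  qed
  have RB: "bform B e1 e1 = 0" "bform B e1 e2 = 0" "bform B e2 e3 = 0" "bform B e3 e3 = 0"
      "bform B e2 e2 = s * bform B e1 e3"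
    using restr[OF symB] zeros by blast+
  have RQ: "bform Q e1 e1 = 0" "bform Q e1 e2 = 0" "bform Q e2 e3 = 0" "bform Q e3 e3 = 0"
      "bform Q e2 e2 = s * bform Q e1 e3"
    using restr[OF symQ] zeros by blast+
  have B13: "bform B e1 e3 \<noteq> 0"
  proof
    assume 0: "bform B e1 e3 = 0"
    have "qform B x = 0" if "bilin u x = 0" for x
    proof -
      obtain a b c d where x: "x = a *s e1 + b *s e2 + c *s e3 + d *s e4"
        using fr unfolding frame_def by blast
      with that H have "d = 0" by (simp add: bilin_simps)
      then show ?thesis unfolding x qform_frame[OF symB] using RB 0 by simp
    qed
    from rank_le_2_if_contains_plane[OF symB u this] assms(3) show False by simp
  qed
  note swapB = bform_sym[OF symB, of e2 e1] bform_sym[OF symB, of e3 e1] bform_sym[OF symB, of e3 e2]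
    bform_sym[OF symB, of e4 e1] bform_sym[OF symB, of e4 e2]
    bform_sym[OF symB, of e4 e3]
  note swapQ = bform_sym[OF symQ, of e2 e1] bform_sym[OF symQ, of e3 e1] bform_sym[OF symQ, of e3 e2]
    bform_sym[OF symQ, of e4 e1] bform_sym[OF symQ, of e4 e2]
    bform_sym[OF symQ, of e4 e3]
  \<comment> \<open>By \<open>RB\<close> and \<open>RQ\<close> both restrictions to the plane are
    determined by their \<open>e1\<close>, \<open>e3\<close> entries; this combination cancels
    them.\<close>
  define l where "l = bform Q e1 e3"
  define m where "m = - bform B e1 e3"
  define T where "T = mscale l B + mscale m Q"
  have T: "bform T x y = bform Q e1 e3 * bform B x y - bform B e1 e3 * bform Q x y" for x y
    by (simp add: T_def bform_pencil l_def m_def)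
  have symT: "transpose T = T" unfolding T_def by (rule transpose_pencil[OF symB symQ])
  have T0: "bform T e1 e1 = 0" "bform T e1 e2 = 0" "bform T e1 e3 = 0"
    "bform T e2 e1 = 0" "bform T e2 e2 = 0" "bform T e2 e3 = 0"
    "bform T e3 e1 = 0" "bform T e3 e2 = 0" "bform T e3 e3 = 0"
    by (simp_all add: T RB RQ swapB swapQ)
  \<comment> \<open>As \<open>T *v x\<close> is a combination of \<open>B *v x\<close> and
    \<open>Q *v x\<close>, it is parallel to \<open>B *v x\<close> too.\<close>
  have tangT: "bform B x v * bform T x w = bform B x w * bform T x v"
    if "2*a*c + s*b^2 = 0" "x = a *s e1 + b *s e2 + c *s e3 + 0 *s e4" for a b c x v w
  proof -
    have "bform B x v * bform Q x w = bform B x w * bform Q x v"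
      using tang zeros[OF that(1)] that(2) by blast
    then show ?thesis unfolding T right_diff_distrib left_diff_distrib by (simp add: mult.left_commute mult.commute)
  qed
  \<comment> \<open>Three points of the conic are tested: \<open>e1\<close>, \<open>e3\<close> and
    \<open>e1 + e2 - (s/2) e3\<close>. At each, \<open>B\<close> pairs the point with a vector of
    the plane to \<open>bform B e1 e3\<close>, which is nonzero, while \<open>T\<close> pairs it to
    zero; by parallelism \<open>T\<close> pairs the point with \<open>e4\<close> to zero.\<close>
  have T14: "bform T e1 e4 = 0"
    using tangT[of 1 0 0 e1 e3 e4] B13 T0 by simp
  have T34: "bform T e3 e4 = 0"
    using tangT[of 0 1 0 e3 e1 e4] B13 T0 swapB by simp
  have T24: "bform T e2 e4 = 0"
    using tangT[of 1 "-s/2" 1 "1 *s e1 + 1 *s e2 + (-s/2) *s e3 + 0 *s e4" e3 e4]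
    by (simp add: bform_simps B13 T0 T14 T34 RB)
  have Te: "T *v e1 = 0" "T *v e2 = 0" "T *v e3 = 0"
    by (rule frame_eq_0[OF fr]; simp add: T0 T14 T24 T34)+
  have "\<exists>d. T *v x = d *s (T *v e4)" for x
  proof -
    obtain a b c d where x: "x = a *s e1 + b *s e2 + c *s e3 + d *s e4"
      using fr unfolding frame_def by blast
    have "T *v x = d *s (T *v e4)"
      by (simp add: x matrix_vector_right_distrib vector_scalar_commute Te)
    then show ?thesis ..
  qed
  then have "rank T \<le> 1" by (rule rank_sym_le_1[OF symT])
  moreover have "(l, m) \<noteq> (0, 0)" using B13 by (simp add: m_def)
  ultimately show ?thesis unfolding T_def by blast
qed

section \<open>Contact along a double line\<close>

text \<open>Proportionality of the rows \<open>f\<close> and \<open>g\<close> needs all six minors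
  to vanish. Four are given directly; the two equations between sums yield the sum and the
  difference of the other two.\<close>

lemma proportional_if_minors:
  fixes f13 f14 f23 f24 :: complex
  assumes "f13 * g14 = f14 * g13" "f23 * g24 = f24 * g23"
    "(f13 + f23) * (g14 + g24) = (f14 + f24) * (g13 + g23)"
    "f13 * g23 = f23 * g13" "f14 * g24 = f24 * g14"
    "(f13 + f14) * (g23 + g24) = (f23 + f24) * (g13 + g14)"
    and "f13 \<noteq> 0 \<or> f14 \<noteq> 0 \<or> f23 \<noteq> 0 \<or> f24 \<noteq> 0"
  shows "\<exists>l m. m \<noteq> 0 \<and> l * f13 + m * g13 = 0 \<and> l * f14 + m * g14 = 0 \<and>
    l * f23 + m * g23 = 0 \<and> l * f24 + m * g24 = 0"
proof -
  have "f13 * g24 = f24 * g13" "f14 * g23 = f23 * g14" using assms(1-6) by algebra+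
  note minors = this assms(1,2,4,5)
  consider "f13 \<noteq> 0" | "f14 \<noteq> 0" | "f23 \<noteq> 0" | "f24 \<noteq> 0" using assms(7) by blast
  then show ?thesis
  proof cases
    case 1
    then show ?thesis using minors by (intro exI[of _ g13] exI[of _ "- f13"]) (simp add: mult.commute)
  next
    case 2
    then show ?thesis using minors by (intro exI[of _ g14] exI[of _ "- f14"]) (simp add: mult.commute)
  next
    case 3
    then show ?thesis using minors by (intro exI[of _ g23] exI[of _ "- f23"]) (simp add: mult.commute)
  next
    case 4
    then show ?thesis using minors by (intro exI[of _ g24] exI[of _ "- f24"]) (simp add: mult.commute)
  qed
qed

text \<open>With nonzero discriminant a complex binary quadratic form has two independent zeros, and
  a vector \<open>(p, q)\<close> orthogonal to both is zero.\<close>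

lemma discriminant_0_if_zeros_dependent:
  fixes t33 t34 t44 :: complex
  assumes zeros: "\<And>c d. (c, d) \<noteq> (0, 0) \<Longrightarrow> t33 * c^2 + 2 * t34 * c * d + t44 * d^2 = 0 \<Longrightarrow>
      c * p + d * q = 0"
    and "p \<noteq> 0 \<or> q \<noteq> 0"
  shows "t34^2 = t33 * t44"
proof (rule ccontr)
  assume disc: "t34^2 \<noteq> t33 * t44"
  show False
  proof (cases "t44 = 0")
    case True
    then have "t34 \<noteq> 0" using disc by auto
    have "q = 0" using zeros[of 0 1] True by simp
    moreover have "2 * t34 * p + (- t33) * q = 0"
      using zeros[of "2 * t34" "- t33"] True \<open>t34 \<noteq> 0\<close> by (simp add: power2_eq_square)
    ultimately show False using \<open>t34 \<noteq> 0\<close> assms(2) by simp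
  next
    case False
    define \<delta> where "\<delta> = csqrt (t34^2 - t33 * t44)"
    have \<delta>: "\<delta>^2 = t34^2 - t33 * t44" by (simp add: \<delta>_def)
    then have "\<delta> \<noteq> 0" using disc by auto
    have root: "t44 * p + (z - t34) * q = 0" if z: "z^2 = \<delta>^2" for z
    proof (rule zeros)
      show "(t44, z - t34) \<noteq> (0, 0)" using False by simp
      show "t33 * t44^2 + 2 * t34 * t44 * (z - t34) + t44 * (z - t34)^2 = 0"
        using z \<delta> by algebra
    qed
    have "2 * \<delta> * q = 0" using root[of \<delta>] root[of "- \<delta>"] by algebra
    then have "q = 0" using \<open>\<delta> \<noteq> 0\<close> by simp
    then show False using root[of \<delta>] False assms(2) by simp
  qed
qed

text \<open>The common zeros are exactly the line of \<open>e1\<close> and \<open>e2\<close>. The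
  numbers \<open>f13\<close> to \<open>f24\<close> and \<open>g13\<close> to \<open>g24\<close> are
  the blocks pairing this line with \<open>e3\<close> and \<open>e4\<close>.\<close>

lemma rank_1_of_contact_double_line:
  fixes B Q :: "complex^4^4"
  assumes symB: "transpose B = B" and symQ: "transpose Q = Q" and "rank B \<ge> 3"
    and fr: "frame e1 e2 e3 e4"
    and zeros: "\<And>a b c d. qform B (a *s e1 + b *s e2 + c *s e3 + d *s e4) = 0 \<and>
      qform Q (a *s e1 + b *s e2 + c *s e3 + d *s e4) = 0 \<longleftrightarrow> c = 0 \<and> d = 0"
    and tang: "\<And>x v w. qform B x = 0 \<Longrightarrow> qform Q x = 0 \<Longrightarrow>
      bform B x v * bform Q x w = bform B x w * bform Q x v"
  shows "\<exists>l m. (l, m) \<noteq> (0, 0) \<and> rank (mscale l B + mscale m Q) \<le> 1"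
proof -
  have restr: "bform M e1 e1 = 0 \<and> bform M e1 e2 = 0 \<and> bform M e2 e2 = 0"
    if M: "transpose M = M" and z: "\<And>a b. qform M (a *s e1 + b *s e2 + 0 *s e3 + 0 *s e4) = 0" for M
    using z[of 1 0, unfolded qform_frame[OF M]] z[of 0 1, unfolded qform_frame[OF M]]
      z[of 1 1, unfolded qform_frame[OF M]] by simp
  have RB: "bform B e1 e1 = 0" "bform B e1 e2 = 0" "bform B e2 e2 = 0"
    using restr[OF symB] zeros by blast+
  have RQ: "bform Q e1 e1 = 0" "bform Q e1 e2 = 0" "bform Q e2 e2 = 0"
    using restr[OF symQ] zeros by blast+
  define f13 where "f13 = bform B e1 e3" define f14 where "f14 = bform B e1 e4"
  define f23 where "f23 = bform B e2 e3" define f24 where "f24 = bform B e2 e4"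
  define g13 where "g13 = bform Q e1 e3" define g14 where "g14 = bform Q e1 e4"
  define g23 where "g23 = bform Q e2 e3" define g24 where "g24 = bform Q e2 e4"
  note defs = f13_def f14_def f23_def f24_def g13_def g14_def g23_def g24_def
  define D where "D M c d = bform M e3 e3 * c^2 + 2 * bform M e3 e4 * c * d + bform M e4 e4 * d^2"
    for M c d
  \<comment> \<open>Since the line is isotropic, the form is affine linear in \<open>a\<close> and
    \<open>b\<close> once \<open>c\<close> and \<open>d\<close> are fixed.\<close>
  have qB: "qform B (a *s e1 + b *s e2 + c *s e3 + d *s e4) =
      2 * (a * (c * f13 + d * f14) + b * (c * f23 + d * f24)) + D B c d" for a b c d
    unfolding qform_frame[OF symB] by (simp add: RB D_def defs algebra_simps)
  have qQ: "qform Q (a *s e1 + b *s e2 + c *s e3 + d *s e4) =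
      2 * (a * (c * g13 + d * g14) + b * (c * g23 + d * g24)) + D Q c d" for a b c d
    unfolding qform_frame[OF symQ] by (simp add: RQ D_def defs algebra_simps)
  have line: "(a * f13 + b * f23) * (a * g14 + b * g24) = (a * f14 + b * f24) * (a * g13 + b * g23)" for a b
    using tang[of "a *s e1 + b *s e2 + 0 *s e3 + 0 *s e4" e3 e4] zeros[of a b 0 0]
    by (simp add: bform_simps defs)
  \<comment> \<open>Were the determinant nonzero, Cramer's rule would give a common zero off the line.\<close>
  have off_line: "(c * f13 + d * f14) * (c * g23 + d * g24) = (c * f23 + d * f24) * (c * g13 + d * g14)" for c d
  proof (cases "c = 0 \<and> d = 0")
    case False
    define \<alpha>1 where "\<alpha>1 = c * f13 + d * f14" define \<alpha>2 where "\<alpha>2 = c * f23 + d * f24"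
    define \<beta>1 where "\<beta>1 = c * g13 + d * g14" define \<beta>2 where "\<beta>2 = c * g23 + d * g24"
    define \<Delta> where "\<Delta> = \<alpha>1 * \<beta>2 - \<alpha>2 * \<beta>1"
    have "\<Delta> = 0"
    proof (rule ccontr)
      assume nz: "\<Delta> \<noteq> 0"
      define a where "a = (D Q c d * \<alpha>2 - D B c d * \<beta>2) / (2 * \<Delta>)"
      define b where "b = (D B c d * \<beta>1 - D Q c d * \<alpha>1) / (2 * \<Delta>)"
      have ab: "2 * \<Delta> * a = D Q c d * \<alpha>2 - D B c d * \<beta>2" "2 * \<Delta> * b = D B c d * \<beta>1 - D Q c d * \<alpha>1"
        using nz by (simp_all add: a_def b_def)
      have "\<Delta> * (2 * (a * \<alpha>1 + b * \<alpha>2) + D B c d) = 0" "\<Delta> * (2 * (a * \<beta>1 + b * \<beta>2) + D Q c d) = 0"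
        using ab \<Delta>_def by algebra+
      then have "2 * (a * \<alpha>1 + b * \<alpha>2) + D B c d = 0" "2 * (a * \<beta>1 + b * \<beta>2) + D Q c d = 0"
        using nz by simp_all
      then show False using zeros[of a b c d] False
        unfolding qB qQ \<alpha>1_def \<alpha>2_def \<beta>1_def \<beta>2_def by blast
    qed
    then show ?thesis unfolding \<Delta>_def \<alpha>1_def \<alpha>2_def \<beta>1_def \<beta>2_def by simp
  qed simp
  \<comment> \<open>With a zero block \<open>B\<close> would annihilate \<open>e1\<close> and
    \<open>e2\<close> and have rank at most two.\<close>
  have A0: "f13 \<noteq> 0 \<or> f14 \<noteq> 0 \<or> f23 \<noteq> 0 \<or> f24 \<noteq> 0"
  proof (rule ccontr)
    assume "\<not> ?thesis"
    then have "B *v e1 = 0" "B *v e2 = 0"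
      using RB bform_sym[OF symB, of e2 e1] by (auto intro!: frame_eq_0[OF fr] simp: defs)
    have "\<exists>c d. B *v x = c *s (B *v e3) + d *s (B *v e4)" for x
    proof -
      obtain a b c d where x: "x = a *s e1 + b *s e2 + c *s e3 + d *s e4"
        using fr unfolding frame_def by blast
      have "B *v x = c *s (B *v e3) + d *s (B *v e4)"
        by (simp add: x matrix_vector_right_distrib vector_scalar_commute
            \<open>B *v e1 = 0\<close> \<open>B *v e2 = 0\<close>)
      then show ?thesis by blast
    qed
    from rank_sym_le_2[OF symB this] assms(3) show False by simp
  qed
  \<comment> \<open>The six minor conditions are \<open>line\<close> and \<open>off_line\<close> at
    (1,0), (0,1) and (1,1).\<close>
  obtain l m where m: "m \<noteq> 0" and lm: "l * f13 + m * g13 = 0" "l * f14 + m * g14 = 0"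
      "l * f23 + m * g23 = 0" "l * f24 + m * g24 = 0"
    using proportional_if_minors[of f13 g14 f14 g13 f23 g24 f24 g23] A0
      line[of 1 0] line[of 0 1] line[of 1 1] off_line[of 1 0] off_line[of 0 1] off_line[of 1 1]
    by auto
  define T where "T = mscale l B + mscale m Q"
  have T: "bform T x y = l * bform B x y + m * bform Q x y" for x y
    by (simp add: T_def bform_pencil)
  have symT: "transpose T = T" unfolding T_def by (rule transpose_pencil[OF symB symQ])
  note swapT = bform_sym[OF symT, of e2 e1] bform_sym[OF symT, of e3 e1] bform_sym[OF symT, of e3 e2]
    bform_sym[OF symT, of e4 e1] bform_sym[OF symT, of e4 e2] bform_sym[OF symT, of e4 e3]
  have T0: "bform T e1 e1 = 0" "bform T e1 e2 = 0" "bform T e1 e3 = 0" "bform T e1 e4 = 0"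
    "bform T e2 e2 = 0" "bform T e2 e3 = 0" "bform T e2 e4 = 0"
    using lm by (simp_all add: T RB RQ defs)
  \<comment> \<open>A zero of T off the line must be missed by B, so B pairs it trivially with the line.\<close>
  have kernel: "c * f13 + d * f14 = 0 \<and> c * f23 + d * f24 = 0"
    if "(c, d) \<noteq> (0, 0)"
      and zT: "bform T e3 e3 * c^2 + 2 * bform T e3 e4 * c * d + bform T e4 e4 * d^2 = 0" for c d
  proof (rule ccontr)
    assume nz: "\<not> ?thesis"
    \<comment> \<open>A nonzero pairing with the line allows \<open>B\<close> to be brought to zero
      by a translation along the line.\<close>
    have "\<exists>a b. 2 * (a * p + b * q) + r = 0" if "\<not> (p = 0 \<and> q = 0)" for p q r :: complex
    proof (cases "p = 0")
      case True
      then show ?thesis using that by (intro exI[of _ 0] exI[of _ "- r / (2 * q)"]) simp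
    next
      case False
      then show ?thesis by (intro exI[of _ "- r / (2 * p)"] exI[of _ 0]) simp
    qed
    from this[OF nz] obtain a b where
      B0: "2 * (a * (c * f13 + d * f14) + b * (c * f23 + d * f24)) + D B c d = 0" by metis
    \<comment> \<open>The blocks cancel in \<open>T\<close>, so its value is independent of
      \<open>a\<close> and \<open>b\<close>. Where \<open>B\<close> and \<open>T\<close> vanish,
      \<open>Q\<close> vanishes as well, because \<open>m\<close> is nonzero.\<close>
    have "l * D B c d + m * D Q c d = 0"
      using zT by (simp add: D_def T algebra_simps)
    then have "m * (2 * (a * (c * g13 + d * g14) + b * (c * g23 + d * g24)) + D Q c d) = 0"
      using B0 lm by algebra
    then have "2 * (a * (c * g13 + d * g14) + b * (c * g23 + d * g24)) + D Q c d = 0"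
      using m by simp
    then show False using B0 zeros[of a b c d] that(1) unfolding qB qQ by simp
  qed
  \<comment> \<open>The vector \<open>(p, q)\<close> is a nonzero row of the block of
    \<open>B\<close>.\<close>
  have disc: "(bform T e3 e4)^2 = bform T e3 e3 * bform T e4 e4"
  proof (cases "f13 = 0 \<and> f14 = 0")
    case True
    with A0 kernel show ?thesis by (intro discriminant_0_if_zeros_dependent[of _ _ _ f23 f24]) auto
  next
    case False
    with kernel show ?thesis by (intro discriminant_0_if_zeros_dependent[of _ _ _ f13 f14]) auto
  qed
  have T12: "T *v e1 = 0" "T *v e2 = 0"
    using T0 swapT by (auto intro!: frame_eq_0[OF fr])
  have "\<exists>p. \<forall>x. \<exists>k. T *v x = k *s p"
  proof -
    have Tx: "\<exists>c d. T *v x = c *s (T *v e3) + d *s (T *v e4)" for x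
    proof -
      obtain a b c d where x: "x = a *s e1 + b *s e2 + c *s e3 + d *s e4"
        using fr unfolding frame_def by blast
      have "T *v x = c *s (T *v e3) + d *s (T *v e4)"
        by (simp add: x matrix_vector_right_distrib vector_scalar_commute T12)
      then show ?thesis by blast
    qed
    \<comment> \<open>The vanishing discriminant makes \<open>T *v e3\<close> and
      \<open>T *v e4\<close> dependent.\<close>
    show ?thesis
    proof (cases "bform T e4 e4 = 0")
      case True
      then have "T *v e4 = 0" using disc T0 swapT by (intro frame_eq_0[OF fr]) auto
      with Tx show ?thesis by (metis add.right_neutral vec.scale_zero_right)
    next
      case False
      define k where "k = bform T e3 e4 / bform T e4 e4"
      have "T *v (e3 - k *s e4) = 0"
        using disc T0 swapT False
        by (intro frame_eq_0[OF fr]) (simp_all add: bform_simps k_def field_simps power2_eq_square)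
      then have "T *v e3 = k *s (T *v e4)"
        by (simp add: matrix_vector_mult_diff_distrib vector_scalar_commute)
      with Tx show ?thesis by (metis vec.scale_scale vec.scale_left_distrib)
    qed
  qed
  then obtain p where "\<And>x. \<exists>k. T *v x = k *s p" by blast
  then have "rank T \<le> 1" by (rule rank_sym_le_1[OF symT])
  then show ?thesis using m unfolding T_def by blast
qed

section \<open>Contact along a conic\<close>

text \<open>The case distinction asks whether \<open>S\<close> restricted to the plane has a zero
  outside its radical. If so, a hyperbolic pair gives the normal form of a reduced conic. If not,
  the restriction, nonzero at \<open>x0\<close>, is the square of a linear form and the conic is a
  double line.\<close>

lemma rank_1_of_contact:
  fixes B Q S :: "complex^4^4"
  assumes symB: "transpose B = B" and symQ: "transpose Q = Q" and symS: "transpose S = S"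
    and rankB: "rank B \<ge> 3" and u: "u \<noteq> 0" and x0: "bilin u x0 = 0" "qform S x0 \<noteq> 0"
    and zeros: "\<And>x. qform B x = 0 \<and> qform Q x = 0 \<longleftrightarrow> bilin u x = 0 \<and> qform S x = 0"
    and tang: "\<And>x v w. qform B x = 0 \<Longrightarrow> qform Q x = 0 \<Longrightarrow>
      bform B x v * bform Q x w = bform B x w * bform Q x v"
  shows "\<exists>l m. (l, m) \<noteq> (0, 0) \<and> rank (mscale l B + mscale m Q) \<le> 1"
proof (cases "\<exists>e y. bilin u e = 0 \<and> bilin u y = 0 \<and> qform S e = 0 \<and> bform S e y \<noteq> 0")
  case True
  then obtain e1 y where e1: "bilin u e1 = 0" "qform S e1 = 0"
    and y: "bilin u y = 0" "bform S e1 y \<noteq> 0" by blast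
  \<comment> \<open>Scaling and subtracting a multiple of \<open>e1\<close> make \<open>e1\<close>,
    \<open>e3\<close> a hyperbolic pair: both isotropic, with pairing one.\<close>
  define z where "z = (1 / bform S e1 y) *s y"
  define e3 where "e3 = z - (qform S z / 2) *s e1"
  have z: "bilin u z = 0" "bform S e1 z = 1" using y by (simp_all add: z_def bilin_simps bform_simps)
  have u3: "bilin u e3 = 0" by (simp add: e3_def bilin_simps z e1)
  have S11: "bform S e1 e1 = 0" using e1(2) by (simp add: qform_bform)
  have S13: "bform S e1 e3 = 1" by (simp add: e3_def bform_simps S11 z)
  have S33: "bform S e3 e3 = 0"
    using bform_sym[OF symS, of z e1] by (simp add: e3_def bform_simps S11 z qform_bform)
  obtain e2 where e2: "e2 \<noteq> 0" "bilin u e2 = 0" "bform S e1 e2 = 0" "bform S e3 e2 = 0"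
    using common_orthogonal[of u "S *v e1" "S *v e3"] unfolding bform_def by blast
  obtain e4 where e4: "bilin u e4 = 1" using bilin_nonzero u by blast
  note swap = bform_sym[OF symS, of e2 e1] bform_sym[OF symS, of e3 e1] bform_sym[OF symS, of e2 e3]
  have fr: "frame e1 e2 e3 e4"
  proof (rule frameI)
    fix a b c d assume 0: "a *s e1 + b *s e2 + c *s e3 + d *s e4 = 0"
    have "bilin u (a *s e1 + b *s e2 + c *s e3 + d *s e4) = d"
      by (simp add: bilin_simps e1 e2 u3 e4)
    then have d: "d = 0" by (simp add: 0 bilin_simps)
    have "bform S e1 (a *s e1 + b *s e2 + c *s e3 + d *s e4) = c"
      by (simp add: bform_simps d S11 S13 e2)
    then have c: "c = 0" by (simp add: 0 bform_simps)
    have "bform S e3 (a *s e1 + b *s e2 + c *s e3 + d *s e4) = a"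
      by (simp add: bform_simps d c swap S33 S13 e2)
    then have a: "a = 0" by (simp add: 0 bform_simps)
    \<comment> \<open>\<open>e2\<close> may be isotropic, so \<open>b\<close> is recovered from
      \<open>e2\<close> being nonzero and not from a pairing.\<close>
    show "a = 0 \<and> b = 0 \<and> c = 0 \<and> d = 0" using 0 a c d e2(1) by simp
  qed
  show ?thesis
  proof (rule rank_1_of_contact_reduced[OF symB symQ rankB u fr e1(1) e2(2) u3])
    show "bilin u e4 \<noteq> 0" using e4 by simp
    fix a b c assume *: "2*a*c + bform S e2 e2 * b^2 = 0"
    have "qform S (a *s e1 + b *s e2 + c *s e3 + 0 *s e4) = 0"
      unfolding qform_frame[OF symS] using * swap by (simp add: S11 S13 S33 e2 algebra_simps)
    moreover have "bilin u (a *s e1 + b *s e2 + c *s e3 + 0 *s e4) = 0"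
      by (simp add: bilin_simps e1 e2 u3)
    ultimately show "qform B (a *s e1 + b *s e2 + c *s e3 + 0 *s e4) = 0 \<and>
        qform Q (a *s e1 + b *s e2 + c *s e3 + 0 *s e4) = 0" using zeros by blast
  qed (rule tang)
next
  case False
  then have rad: "bform S e y = 0" if "bilin u e = 0" "bilin u y = 0" "qform S e = 0" for e y
    using that by blast
  \<comment> \<open>Otherwise some \<open>z *s x + x0\<close> would be a zero of \<open>S\<close>,
    hence in the radical, yet its pairing with \<open>x0\<close> is
    \<open>qform S x0\<close>.\<close>
  have iso: "qform S x = 0" if x: "bilin u x = 0" "bform S x0 x = 0" for x
  proof (rule ccontr)
    assume nz: "qform S x \<noteq> 0"
    define z where "z = csqrt (- qform S x0 / qform S x)"
    have z: "z^2 * qform S x = - qform S x0" using nz by (simp add: z_def)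
    have "bform S x x0 = 0" using x(2) bform_sym[OF symS] by metis
    then have "qform S (z *s x + x0) = 0"
      using z x(2) by (simp add: qform_bform bform_simps power2_eq_square mult.assoc)
    then have "bform S (z *s x + x0) x0 = 0" by (rule rad[rotated 2]) (simp_all add: bilin_simps x x0)
    then show False using x0(2) \<open>bform S x x0 = 0\<close> by (simp add: bform_simps qform_bform)
  qed
  \<comment> \<open>Only two conditions are wanted; the third vector is the dummy 0.\<close>
  obtain e1 where e1: "e1 \<noteq> 0" "bilin u e1 = 0" "bform S x0 e1 = 0"
    using common_orthogonal[of u "S *v x0" 0] unfolding bform_def by blast
  \<comment> \<open>Orthogonality to \<open>w\<close> keeps \<open>e2\<close> from being a multiple
    of \<open>e1\<close>.\<close>
  obtain w where w: "bilin e1 w = 1" using bilin_nonzero e1(1) by blast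
  obtain e2 where e2: "e2 \<noteq> 0" "bilin u e2 = 0" "bform S x0 e2 = 0" "bilin w e2 = 0"
    using common_orthogonal[of u "S *v x0" w] unfolding bform_def by blast
  obtain e4 where e4: "bilin u e4 = 1" using bilin_nonzero u by blast
  have fr: "frame e1 e2 x0 e4"
  proof (rule frameI)
    fix a b c d assume 0: "a *s e1 + b *s e2 + c *s x0 + d *s e4 = 0"
    have "bilin u (a *s e1 + b *s e2 + c *s x0 + d *s e4) = d"
      by (simp add: bilin_simps e1 e2 x0 e4)
    then have d: "d = 0" by (simp add: 0 bilin_simps)
    have "bform S x0 (a *s e1 + b *s e2 + c *s x0 + d *s e4) = c * qform S x0"
      by (simp add: bform_simps d e1 e2 qform_bform)
    then have c: "c = 0" using x0(2) by (simp add: 0 bform_simps)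
    have "bilin w (a *s e1 + b *s e2 + c *s x0 + d *s e4) = a"
      using w e2(4) by (simp add: bilin_simps c d bilin_commute[of w e1])
    then have a: "a = 0" by (simp add: 0 bilin_simps)
    show "a = 0 \<and> b = 0 \<and> c = 0 \<and> d = 0" using 0 a c d e2(1) by simp
  qed
  have S: "bform S e1 e1 = 0" "bform S e2 e2 = 0" "bform S e1 e2 = 0"
      "bform S e1 x0 = 0" "bform S e2 x0 = 0"
    using iso[of e1] iso[of e2] rad[of e1 e2] rad[of e1 x0] rad[of e2 x0] e1 e2 x0
    by (simp_all add: qform_bform)
  show ?thesis
  proof (rule rank_1_of_contact_double_line[OF symB symQ rankB fr])
    fix a b c d
    have "bilin u (a *s e1 + b *s e2 + c *s x0 + d *s e4) = d"
      by (simp add: bilin_simps e1 e2 x0 e4)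
    moreover have "qform S (a *s e1 + b *s e2 + c *s x0 + 0 *s e4) = c^2 * qform S x0"
      unfolding qform_frame[OF symS] by (simp add: S qform_bform)
    ultimately show "qform B (a *s e1 + b *s e2 + c *s x0 + d *s e4) = 0 \<and>
        qform Q (a *s e1 + b *s e2 + c *s x0 + d *s e4) = 0 \<longleftrightarrow> c = 0 \<and> d = 0"
      using x0(2) unfolding zeros by auto
  qed (rule tang)
qed

section \<open>Points and quadrics\<close>

lemma rank_mscale:
  assumes "c \<noteq> 0" shows "rank (mscale c Q) = rank Q"
proof -
  have le: "rank (mscale c M) \<le> rank M" for c and M :: "complex^4^4"
  proof -
    have "c *s row i M \<in> vec.span (rows M)" for i
      by (rule vec.span_scale) (auto simp: rows_def intro: vec.span_base)
    moreover have "row i (mscale c M) = c *s row i M" for i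
      by (simp add: row_def mscale_def vec_eq_iff)
    ultimately have "rows (mscale c M) \<subseteq> vec.span (rows M)" by (auto simp: rows_def)
    then show ?thesis unfolding row_rank_def_gen by (rule vec.dim_mono)
  qed
  have "mscale (1 / c) (mscale c Q) = Q" using assms by (simp add: mscale_def vec_eq_iff)
  then show ?thesis using le[of c Q] le[of "1 / c" "mscale c Q"] by simp
qed

lemma mscale_1: "mscale 1 Q = Q"
  by (simp add: mscale_def vec_eq_iff)

lemma mscale_mscale: "mscale c (mscale d Q) = mscale (c * d) Q"
  by (simp add: mscale_def vec_eq_iff mult.assoc)

lemma in_quadric_of: "Q \<in> quadric_of Q"
  unfolding quadric_of_def using mscale_1[of Q] by (metis (mono_tags, lifting) mem_Collect_eq one_neq_zero)

lemma quadric_rank_eq: "quadric_rank (quadric_of Q) = rank Q"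
  unfolding quadric_rank_def
proof (rule the_equality)
  show "\<exists>R\<in>quadric_of Q. rank R = rank Q" using in_quadric_of by blast
  show "r = rank Q" if "\<exists>R\<in>quadric_of Q. rank R = r" for r
    using that rank_mscale by (auto simp: quadric_of_def)
qed

lemma quadric_of_mscale:
  assumes "c \<noteq> 0" shows "quadric_of (mscale c Q) = quadric_of Q"
proof -
  have "mscale d Q \<in> quadric_of (mscale c Q)" if "d \<noteq> 0" for d
    using assms that unfolding quadric_of_def mscale_mscale
    by (intro CollectI exI[of _ "d / c"]) simp
  then show ?thesis using assms by (auto simp: quadric_of_def mscale_mscale)
qed

section \<open>Incidence and tangency in terms of representatives\<close>

lemma Bex_quadric_of: "(\<exists>R\<in>quadric_of Q. P R) \<longleftrightarrow> (\<exists>c. c \<noteq> 0 \<and> P (mscale c Q))"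
  by (auto simp: quadric_of_def)

lemma Bex_point_of: "(\<exists>y\<in>point_of x. P y) \<longleftrightarrow> (\<exists>c. c \<noteq> 0 \<and> P (c *s x))"
  by (auto simp: point_of_def)

lemma point_of_in_P3: "x \<noteq> 0 \<Longrightarrow> point_of x \<in> P3"
  by (auto simp: P3_def)

lemma point_in_zero_set:
  assumes "x \<noteq> 0"
  shows "point_of x \<in> zero_set (quadric_of Q) \<longleftrightarrow> qform Q x = 0"
  unfolding zero_set_def mem_Collect_eq Bex_quadric_of Bex_point_of
  using point_of_in_P3[OF assms] by (auto simp: qform_bform bform_mscale bform_simps intro: exI[of _ 1])

lemma point_in_plane:
  assumes "x \<noteq> 0"
  shows "point_of x \<in> {p \<in> P3. \<exists>x\<in>p. bilin u x = 0} \<longleftrightarrow> bilin u x = 0"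
  unfolding Bex_point_of mem_Collect_eq
  using point_of_in_P3[OF assms] by (auto simp: bilin_simps intro: exI[of _ 1])

lemma smooth_at_point:
  assumes "x \<noteq> 0"
  shows "smooth_at (quadric_of Q) (point_of x) \<longleftrightarrow> qform Q x = 0 \<and> Q *v x \<noteq> 0"
  unfolding smooth_at_def point_in_zero_set[OF assms] Bex_quadric_of Bex_point_of
  by (auto simp: mscale_mult vector_scalar_commute intro: exI[of _ 1])

lemma point_in_tangent_plane:
  assumes "y \<noteq> 0"
  shows "point_of y \<in> tangent_plane (quadric_of Q) (point_of x) \<longleftrightarrow> bform Q x y = 0"
  unfolding tangent_plane_def Bex_quadric_of Bex_point_of mem_Collect_eq
  using point_of_in_P3[OF assms]
  by (auto simp: bform_def mscale_mult vector_scalar_commute bilin_simps intro: exI[of _ 1])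

lemma P3_subset_eqI:
  assumes "X \<subseteq> P3" "Y \<subseteq> P3" "\<And>x. x \<noteq> 0 \<Longrightarrow> point_of x \<in> X \<longleftrightarrow> point_of x \<in> Y"
  shows "X = Y"
  using assms unfolding P3_def by blast

text \<open>Polar vectors with the same orthogonal complement are parallel. The witness
  \<open>y\<close> is a combination of \<open>v\<close> and \<open>w\<close> orthogonal to
  \<open>B *v x\<close>; when it is zero it gives no point, but the claim is then immediate.\<close>

lemma parallel_if_same_tangent_plane:
  assumes "x \<noteq> 0" and eq: "tangent_plane (quadric_of B) (point_of x) = tangent_plane (quadric_of Q) (point_of x)"
  shows "bform B x v * bform Q x w = bform B x w * bform Q x v"
proof -
  define y where "y = bform B x w *s v - bform B x v *s w"
  have "bform B x y = 0" by (simp add: y_def bform_simps)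
  then have "bform Q x y = 0"
    using eq point_in_tangent_plane[of y] by (cases "y = 0") (auto simp: bform_simps)
  then show ?thesis by (simp add: y_def bform_simps)
qed

text \<open>The pencil runs over all representatives of both quadrics; their nonzero factors are
  absorbed into \<open>l\<close> and \<open>m\<close>.\<close>

lemma pencil_meets_rank_one_iff:
  assumes "transpose B = B" "transpose Q = Q"
  shows "pencil (quadric_of B) (quadric_of Q) \<inter> rank_one_locus \<noteq> {} \<longleftrightarrow>
    (\<exists>l m. (l, m) \<noteq> (0, 0) \<and> rank (mscale l B + mscale m Q) = 1)"
proof
  assume "pencil (quadric_of B) (quadric_of Q) \<inter> rank_one_locus \<noteq> {}"
  then obtain l m c d where *: "c \<noteq> 0" "d \<noteq> 0" "(l, m) \<noteq> (0, 0)"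
      "quadric_of (mscale l (mscale c B) + mscale m (mscale d Q)) \<in> rank_one_locus"
    unfolding pencil_def quadric_of_def[of B] quadric_of_def[of Q] by blast
  then have "rank (mscale (l * c) B + mscale (m * d) Q) = 1"
    by (simp add: rank_one_locus_def quadric_rank_eq mscale_mscale)
  moreover have "(l * c, m * d) \<noteq> (0, 0)" using * by simp
  ultimately show "\<exists>l m. (l, m) \<noteq> (0, 0) \<and> rank (mscale l B + mscale m Q) = 1" by blast
next
  assume "\<exists>l m. (l, m) \<noteq> (0, 0) \<and> rank (mscale l B + mscale m Q) = 1"
  then obtain l m where lm: "(l, m) \<noteq> (0, 0)" "rank (mscale l B + mscale m Q) = 1" by blast
  then have "mscale l B + mscale m Q \<noteq> 0" using rank_0_iff[of "mscale l B + mscale m Q"] by auto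
  then have "quadric_of (mscale l B + mscale m Q) \<in> rank_one_locus"
    unfolding rank_one_locus_def P9_def using transpose_pencil[OF assms] lm(2)
    by (auto simp: quadric_rank_eq)
  moreover have "quadric_of (mscale l B + mscale m Q) \<in> pencil (quadric_of B) (quadric_of Q)"
    unfolding pencil_def using lm(1) in_quadric_of by blast
  ultimately show "pencil (quadric_of B) (quadric_of Q) \<inter> rank_one_locus \<noteq> {}" by blast
qed

section \<open>Contact along a conic and double planes in the pencil\<close>

theorem proposition0p1:
  fixes b q :: "(complex^4^4) set"
  assumes "b \<in> P9" and "q \<in> P9" and "b \<noteq> q"
    and "quadric_rank b \<ge> 3" and "quadric_rank q \<ge> 3"
  shows "basket b q \<longleftrightarrow> pencil b q \<inter> rank_one_locus \<noteq> {}"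
proof -
  obtain B where B: "b = quadric_of B" "transpose B = B" using assms(1) by (auto simp: P9_def)
  obtain Q where Q: "q = quadric_of Q" "transpose Q = Q" using assms(2) by (auto simp: P9_def)
  have rankB: "rank B \<ge> 3" and rankQ: "rank Q \<ge> 3"
    using assms(4,5) by (simp_all add: B Q quadric_rank_eq)
  show ?thesis
  proof
    assume "basket b q"
    then obtain C where "C \<in> conics" and tan: "tangent_along b q C" and C: "zero_set b \<inter> zero_set q = C"
      unfolding basket_def by blast
    then obtain H s where H: "H \<in> planes" and s: "s \<in> P9" and nsub: "\<not> H \<subseteq> zero_set s"
        and CH: "C = H \<inter> zero_set s"
      unfolding conics_def by blast
    obtain u where u: "u \<noteq> 0" and Hu: "H = {p \<in> P3. \<exists>x\<in>p. bilin u x = 0}"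
      using H unfolding planes_def by blast
    obtain S where S: "s = quadric_of S" "transpose S = S" using s by (auto simp: P9_def)
    obtain x0 where x0: "x0 \<noteq> 0" "point_of x0 \<in> H" "point_of x0 \<notin> zero_set s"
      using nsub unfolding Hu P3_def by blast
    have zeros: "qform B x = 0 \<and> qform Q x = 0 \<longleftrightarrow> bilin u x = 0 \<and> qform S x = 0" for x
    proof (cases "x = 0")
      case True
      then show ?thesis by (simp add: qform_bform bform_simps bilin_simps)
    next
      case False
      then show ?thesis
        using C point_in_plane[OF False, of u]
        by (simp add: CH B Q S set_eq_iff point_in_zero_set[symmetric] flip: Hu)
    qed
    \<comment> \<open>Tangent planes are compared at points smooth on both quadrics; at the other
      points a polar vector is zero and both sides vanish.\<close>
    have tang: "bform B x v * bform Q x w = bform B x w * bform Q x v"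
      if x: "qform B x = 0" "qform Q x = 0" for x v w
    proof (cases "x = 0 \<or> B *v x = 0 \<or> Q *v x = 0")
      case True
      then show ?thesis by (auto simp: bform_def bilin_simps)
    next
      case False
      then have "x \<noteq> 0" by blast
      moreover have "point_of x \<in> C"
        using x C[symmetric] point_in_zero_set[OF \<open>x \<noteq> 0\<close>] by (simp add: B Q)
      ultimately have "tangent_plane b (point_of x) = tangent_plane q (point_of x)"
        using tan False x unfolding tangent_along_def by (simp add: B Q smooth_at_point)
      then show ?thesis unfolding B(1) Q(1) by (rule parallel_if_same_tangent_plane[OF \<open>x \<noteq> 0\<close>])
    qed
    have "bilin u x0 = 0" "qform S x0 \<noteq> 0"
      using x0 point_in_plane[OF x0(1), of u] by (simp_all add: Hu S point_in_zero_set)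
    from rank_1_of_contact[OF B(2) Q(2) S(2) rankB u this zeros tang]
    obtain l m where lm: "(l, m) \<noteq> (0, 0)" and le: "rank (mscale l B + mscale m Q) \<le> 1" by blast
    \<comment> \<open>A vanishing combination would make \<open>B\<close> and \<open>Q\<close>
      proportional, contrary to \<open>b\<close> and \<open>q\<close> being distinct.\<close>
    have "mscale l B + mscale m Q \<noteq> 0"
    proof
      assume 0: "mscale l B + mscale m Q = 0"
      have eq: "l * B $ i $ j + m * Q $ i $ j = 0" for i j
        using arg_cong[OF 0, of "\<lambda>M. M $ i $ j"] by (simp add: mscale_def)
      have "l \<noteq> 0"
      proof
        assume "l = 0"
        then have "Q = 0" using eq lm by (simp add: vec_eq_iff)
        then show False using rankQ rank_0_iff[of Q] by simp
      qed
      have "m \<noteq> 0"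
      proof
        assume "m = 0"
        then have "B = 0" using eq lm by (simp add: vec_eq_iff)
        then show False using rankB rank_0_iff[of B] by simp
      qed
      have "B = mscale (- m / l) Q"
        using eq \<open>l \<noteq> 0\<close> by (simp add: mscale_def vec_eq_iff field_simps add_eq_0_iff)
      then have "b = q" using \<open>l \<noteq> 0\<close> \<open>m \<noteq> 0\<close> by (simp add: B(1) Q(1) quadric_of_mscale)
      then show False using assms(3) by blast
    qed
    then have "rank (mscale l B + mscale m Q) = 1"
      using le rank_0_iff[of "mscale l B + mscale m Q"] by linarith
    then show "pencil b q \<inter> rank_one_locus \<noteq> {}"
      unfolding B(1) Q(1) pencil_meets_rank_one_iff[OF B(2) Q(2)] using lm by blast
  next
    assume "pencil b q \<inter> rank_one_locus \<noteq> {}"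
    then obtain l m where lm: "(l, m) \<noteq> (0, 0)" "rank (mscale l B + mscale m Q) = 1"
      unfolding B(1) Q(1) pencil_meets_rank_one_iff[OF B(2) Q(2)] by blast
    obtain u c where u: "u \<noteq> 0" and c: "c \<noteq> 0"
        and T: "\<And>x. (mscale l B + mscale m Q) *v x = (c * bilin u x) *s u"
      using rank_1_symE[OF transpose_pencil[OF B(2) Q(2)] lm(2)] by blast
    have T': "l * bform B x y + m * bform Q x y = c * bilin u x * bilin u y" for x y
      unfolding bform_pencil[symmetric] by (simp add: bform_def T bilin_simps)
    \<comment> \<open>If one coefficient were zero, the rank one member would be a nonzero multiple
      of \<open>Q\<close> or \<open>B\<close>, which have rank at least three.\<close>
    have "l \<noteq> 0"
      using lm rankQ rank_mscale[of m Q] by (auto simp: mscale_def zero_vec_def[symmetric])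
    have "m \<noteq> 0"
      using lm rankB rank_mscale[of l B] by (auto simp: mscale_def zero_vec_def[symmetric])
    define H where "H = {p \<in> P3. \<exists>x\<in>p. bilin u x = 0}"
    have "H \<in> planes" unfolding planes_def H_def using u by blast
    have "\<not> H \<subseteq> zero_set b"
    proof
      assume sub: "H \<subseteq> zero_set b"
      have "qform B x = 0" if "bilin u x = 0" for x
      proof (cases "x = 0")
        case False
        then show ?thesis
          using sub that point_in_plane[OF False, of u] point_in_zero_set[OF False, of B]
          by (auto simp: H_def B(1))
      qed (simp add: qform_bform bform_simps)
      from rank_le_2_if_contains_plane[OF B(2) u this] rankB show False by simp
    qed
    with \<open>H \<in> planes\<close> have "H \<inter> zero_set b \<in> conics" unfolding conics_def using assms(1) by blast
    moreover have eq: "zero_set b \<inter> zero_set q = H \<inter> zero_set b"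
    proof (rule P3_subset_eqI)
      fix x :: "complex^4" assume x: "x \<noteq> 0"
      \<comment> \<open>By \<open>T'\<close> on the diagonal, \<open>l\<close> times the form of
        \<open>B\<close> plus \<open>m\<close> times that of \<open>Q\<close> is \<open>c\<close>
        times the square of the equation of \<open>H\<close>.\<close>
      have "qform B x = 0 \<and> qform Q x = 0 \<longleftrightarrow> bilin u x = 0 \<and> qform B x = 0"
        using T'[of x x] \<open>m \<noteq> 0\<close> c by (auto simp: qform_bform)
      then show "point_of x \<in> zero_set b \<inter> zero_set q \<longleftrightarrow> point_of x \<in> H \<inter> zero_set b"
        using point_in_plane[OF x, of u] unfolding H_def B(1) Q(1) Int_iff point_in_zero_set[OF x] by blast
    qed (auto simp: zero_set_def)
    moreover have "tangent_along b q (H \<inter> zero_set b)"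
      unfolding tangent_along_def
    proof (intro conjI ballI impI)
      fix p assume p: "p \<in> H \<inter> zero_set b"
      then obtain x where x: "x \<noteq> 0" "p = point_of x" by (auto simp: H_def P3_def)
      then have "bilin u x = 0" using p point_in_plane[OF x(1), of u] by (simp add: H_def)
      \<comment> \<open>On \<open>H\<close> the right side of \<open>T'\<close> vanishes, so the
        polar vectors of \<open>B\<close> and \<open>Q\<close> are nonzero multiples of each
        other.\<close>
      then have "bform B x y = 0 \<longleftrightarrow> bform Q x y = 0" for y
        using T'[of x y] \<open>l \<noteq> 0\<close> \<open>m \<noteq> 0\<close> by auto
      then show "tangent_plane b p = tangent_plane q p"
        unfolding B(1) Q(1) x(2)
        by (intro P3_subset_eqI) (auto simp: point_in_tangent_plane, auto simp: tangent_plane_def)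
    qed (use eq in blast)
    ultimately show "basket b q" unfolding basket_def using assms by blast
  qed
qed

end
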